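(* Let $E_1,\dots,E_m$ be solid ellipsoids in $\mathbb{R}^N$ given by $E_j=\{A_j\mathbf v:\ \mathbf v\in\mathbb{R}^N,\ \|\mathbf v\|<1\}$, $j=1,\dots,m$, where each $A_j$ is a symmetric positive-definite $N\times N$ real matrix. Then the boundary $\partial\Sigma$ of the Minkowski sum $\Sigma:=E_1+\cdots+E_m$ is given parametrically by $$\mathbf x_{\partial\Sigma}(\mathbf n)=\sum_{i=1}^m\frac{A_i^2\mathbf n}{\|A_i\mathbf n\|},\qquad \mathbf n\in\mathbb{S}^{N-1}.$$ Furthermore, for every $\mathbf n\in\mathbb{S}^{N-1}$, $\mathbf n$ is the outward-pointing unit normal to the boundary of $\Sigma$ at the point $\mathbf x_{\partial\Sigma}(\mathbf n)$.
   Context: $\|\cdot\|$ is the Euclidean norm and $\mathbb{S}^{N-1}$ is the unit sphere in $\mathbb{R}^N$. The Minkowski sum of sets is $B_1+B_2=\{\mathbf x+\mathbf y:\mathbf x\in B_1,\ \mathbf y\in B_2\}$. "$\partial\Sigma$ is given parametrically by $\mathbf x_{\partial\Sigma}$" means that $\partial\Sigma$ is the image of the map $\mathbf x_{\partial\Sigma}:\mathbb{S}^{N-1}\to\mathbb{R}^N$. *)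

theory Defs
  imports "HOL-Analysis.Analysis" "HOL-Library.Set_Algebras"
begin

definition sym_pos_def :: "real^'n^'n \<Rightarrow> bool" where
  "sym_pos_def A \<longleftrightarrow> transpose A = A \<and> (\<forall>v. v \<noteq> 0 \<longrightarrow> v \<bullet> (A *v v) > 0)"

definition solid_ellipsoid :: "real^'n^'n \<Rightarrow> (real^'n) set" where
  "solid_ellipsoid A = {A *v v | v. norm v < 1}"

(* The sum of sets is the Minkowski sum provided by HOL-Library.Set_Algebras. *)
definition ellipsoid_sum :: "nat \<Rightarrow> (nat \<Rightarrow> real^'n^'n) \<Rightarrow> (real^'n) set" where
  "ellipsoid_sum m A = (\<Sum>j=1..m. solid_ellipsoid (A j))"

definition boundary_param :: "nat \<Rightarrow> (nat \<Rightarrow> real^'n^'n) \<Rightarrow> real^'n \<Rightarrow> real^'n" where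
  "boundary_param m A n = (\<Sum>i=1..m. ((A i ** A i) *v n) /\<^sub>R norm (A i *v n))"

(* Near x the boundary of S is a C^1 hypersurface with S lying on one side of it: g is a
   C^1 function on the neighbourhood U with non-vanishing gradient G that is negative
   exactly on S and zero exactly on the boundary of S. The tangent hyperplane at x is the
   orthogonal complement of G x, and G x points out of S. *)
definition outward_unit_normal :: "'a::euclidean_space set \<Rightarrow> 'a \<Rightarrow> 'a \<Rightarrow> bool" where
  "outward_unit_normal S x n \<longleftrightarrow>
     x \<in> frontier S \<and>
     (\<exists>U g G. open U \<and> x \<in> U \<and>
        (\<forall>y\<in>U. GDERIV g y :> G y \<and> G y \<noteq> 0) \<and> continuous_on U G \<and>
        S \<inter> U = {y \<in> U. g y < 0} \<and>
        frontier S \<inter> U = {y \<in> U. g y = 0} \<and>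
        n = G x /\<^sub>R norm (G x))"

lemma gderiv_ray:
  assumes "GDERIV g x :> D"
  shows "((\<lambda>t. g (x + t *\<^sub>R v)) has_real_derivative v \<bullet> D) (at 0)"
proof -
  have *: "(g has_derivative (\<lambda>h. h \<bullet> D)) (at (x + 0 *\<^sub>R v))"
    using assms by (simp add: gderiv_def)
  have "((\<lambda>t. x + t *\<^sub>R v) has_derivative (\<lambda>t. t *\<^sub>R v)) (at 0)"
    by (auto intro!: derivative_eq_intros)
  from has_derivative_compose[OF this *]
  show ?thesis
    unfolding has_field_derivative_def
    by (rule has_derivative_eq_rhs) (simp add: fun_eq_iff)
qed

(* The choice of the local defining function g is immaterial. *)
lemma outward_unit_normal_unique:
  assumes "outward_unit_normal S x a" "outward_unit_normal S x b"
  shows "a = b"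
proof (rule ccontr)
  assume "a \<noteq> b"
  from assms(1) obtain U g G where g: "open U" "x \<in> U" "GDERIV g x :> G x" "G x \<noteq> 0"
    "S \<inter> U = {y \<in> U. g y < 0}" "frontier S \<inter> U = {y \<in> U. g y = 0}"
    "a = G x /\<^sub>R norm (G x)" and x: "x \<in> frontier S"
    unfolding outward_unit_normal_def by blast
  from assms(2) obtain V h H where h: "open V" "x \<in> V" "GDERIV h x :> H x" "H x \<noteq> 0"
    "S \<inter> V = {y \<in> V. h y < 0}" "frontier S \<inter> V = {y \<in> V. h y = 0}"
    "b = H x /\<^sub>R norm (H x)"
    unfolding outward_unit_normal_def by blast
  have g0: "g x = 0" and h0: "h x = 0"
    using x g(2,6) h(2,6) by blast+
  have na: "a \<bullet> a = 1" and nb: "b \<bullet> b = 1"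
    using g(4,7) h(4,7) by (simp_all add: dot_square_norm)
  have "(a - b) \<bullet> (a - b) > 0"
    using \<open>a \<noteq> b\<close> by simp
  then have ab: "a \<bullet> b < 1"
    using na nb by (simp add: inner_diff inner_commute)
  define v where "v = b - a"
  have "v \<bullet> a < 0" "v \<bullet> b > 0"
    using ab na nb by (simp_all add: v_def inner_diff inner_commute)
  then have "v \<bullet> G x < 0" "v \<bullet> H x > 0"
    using g(4,7) h(4,7) by (auto simp: field_simps zero_less_mult_iff mult_less_0_iff)
  with g0 h0 DERIV_neg_dec_right[OF gderiv_ray[OF g(3), of v]]
    DERIV_pos_inc_right[OF gderiv_ray[OF h(3), of v]]
  obtain d e where d: "d > 0" "\<And>t. 0 < t \<Longrightarrow> t < d \<Longrightarrow> g (x + t *\<^sub>R v) < 0"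
    and e: "e > 0" "\<And>t. 0 < t \<Longrightarrow> t < e \<Longrightarrow> h (x + t *\<^sub>R v) > 0"
    by auto
  have "((\<lambda>t. x + t *\<^sub>R v) \<longlongrightarrow> x + 0 *\<^sub>R v) (at_right 0)"
    by (intro tendsto_intros)
  moreover have "open (U \<inter> V)" "x + 0 *\<^sub>R v \<in> U \<inter> V"
    using g h by auto
  ultimately have "\<forall>\<^sub>F t in at_right 0. x + t *\<^sub>R v \<in> U \<inter> V"
    by (rule topological_tendstoD)
  moreover have "\<forall>\<^sub>F t in at_right 0. 0 < t \<and> t < min d e"
    using d(1) e(1) eventually_at_right_real[of 0 "min d e"] by simp
  ultimately have "\<forall>\<^sub>F t in at_right (0::real). False"
  proof eventually_elim
    case (elim t)
    then have "x + t *\<^sub>R v \<in> S"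
      using d(2)[of t] g(5) by auto
    moreover have "x + t *\<^sub>R v \<in> V"
      using elim by simp
    ultimately have "x + t *\<^sub>R v \<in> {y \<in> V. h y < 0}"
      unfolding h(5)[symmetric] by (rule IntI)
    then show False
      using elim e(2)[of t] by simp
  qed
  then show False
    by simp
qed

end

theory Submission
  imports Defs
begin

text \<open>
  Write \<open>S\<close> for the sum. Two facts about \<open>S\<close> give the theorem.

  The point \<open>A\<^sup>2 n / \<parallel>A n\<parallel>\<close> is the only point of the closed ellipsoid of \<open>A\<close> at which the functional
  \<open>y \<mapsto> n \<bullet> y\<close> is maximal: this is the equality case of the Cauchy-Schwarz inequality for
  \<open>n \<bullet> A v = A n \<bullet> v\<close>. Unique maximizers add up under Minkowski sums, so the sum \<open>p n\<close> of these
  points is the unique maximizer of the functional on the closure of \<open>S\<close>. Each frontier point of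
  the open convex set \<open>S\<close> lies on a supporting hyperplane, hence is \<open>p n\<close> for the unit normal \<open>n\<close> of
  that hyperplane. This shows that the frontier is contained in the image of \<open>p\<close>.

  For the normals a \<open>C\<^sup>1\<close> function that defines \<open>S\<close> near \<open>p n\<close> is needed. Such a function comes from
  singling out one ellipsoid, with matrix \<open>A\<close>: if \<open>R\<close> is the sum of the others, then \<open>S\<close> is the
  image under \<open>A\<close> of the unit ball plus \<open>A\<^sup>-\<^sup>1 R\<close>, that is, of the open tube of radius 1 around the closed
  convex set \<open>L = closure (A\<^sup>-\<^sup>1 R)\<close>. The squared distance to a closed convex set is everywhere
  differentiable; its gradient \<open>2 (z - P z)\<close>, with \<open>P\<close> the closest point map, is continuous, and
  vanishes only on the set. So the tube has outward normal \<open>z - P z\<close> at its frontier points \<open>z\<close>, and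
  a linear isomorphism carries normals to normals by the inverse adjoint. At \<open>z = A\<^sup>-\<^sup>1 (p n)\<close> the
  maximizing property of the points for \<open>R\<close> identifies \<open>z - P z\<close> as \<open>A n / \<parallel>A n\<parallel>\<close>, which \<open>A\<^sup>-\<^sup>1\<close>
  takes to a positive multiple of \<open>n\<close>. Having a normal includes being a frontier point, so this
  also gives the other inclusion between the frontier and the image of \<open>p\<close>.
\<close>

section \<open>Distance to a convex set\<close>

lemma infdist_eq_dist_closest_point:
  fixes L :: "'a::euclidean_space set"
  assumes "closed L" "L \<noteq> {}"
  shows "infdist z L = dist z (closest_point L z)"
  using assms by (simp add: infdist_eq_setdist setdist_closest_point)

text \<open>
  Converse of \<open>closest_point_dot\<close>: if the angle at \<open>p\<close> between \<open>z\<close> and each point \<open>l\<close> of the set is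
  not acute, the law of cosines makes \<open>p\<close> at least as close to \<open>z\<close> as \<open>l\<close>.
\<close>

lemma closest_point_obtuse:
  fixes L :: "'a::euclidean_space set"
  assumes "convex L" "closed L" "p \<in> L" "\<And>l. l \<in> L \<Longrightarrow> (z - p) \<bullet> (l - p) \<le> 0"
  shows "closest_point L z = p"
proof -
  have "dist z p \<le> dist z l" if "l \<in> L" for l
  proof -
    have "(dist z l)\<^sup>2 = (dist z p)\<^sup>2 + (dist p l)\<^sup>2 - 2 * ((z - p) \<bullet> (l - p))"
      by (simp add: dist_norm power2_norm_eq_inner inner_diff inner_commute)
    then have "(dist z p)\<^sup>2 \<le> (dist z l)\<^sup>2"
      using assms(4)[OF that] by (smt (verit) zero_le_power2)
    then show ?thesis
      by (rule power2_le_imp_le) simp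
  qed
  then show ?thesis
    using closest_point_unique[OF assms(1-3)] by metis
qed

text \<open>
  The squared distance at \<open>y\<close> is at most the squared distance from \<open>y\<close> to the closest point of \<open>z\<close>,
  and conversely with \<open>y\<close> and \<open>z\<close> exchanged. The first comparison bounds the remainder of the linear
  approximation from above by \<open>\<parallel>y - z\<parallel>\<^sup>2\<close>; the second bounds it from below by \<open>-\<parallel>y - z\<parallel>\<^sup>2\<close>, since the
  closest point map does not increase distances. Squaring avoids the singularity of the distance
  on the set itself.
\<close>

lemma GDERIV_infdist_sq:
  fixes L :: "'a::euclidean_space set"
  assumes "convex L" "closed L" "L \<noteq> {}"
  shows "GDERIV (\<lambda>z. (infdist z L)\<^sup>2) z :> 2 *\<^sub>R (z - closest_point L z)"
proof -
  let ?P = "closest_point L"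
  have sq: "(infdist y L)\<^sup>2 = (y - ?P y) \<bullet> (y - ?P y)" for y
    using assms by (simp add: infdist_eq_dist_closest_point dist_norm power2_norm_eq_inner)
  have le: "(infdist y L)\<^sup>2 \<le> (y - ?P x) \<bullet> (y - ?P x)" for x y
    using assms infdist_le[of "?P x" L y]
    by (simp add: closest_point_in_set dist_norm infdist_nonneg power_mono flip: power2_norm_eq_inner)
  have bound: "\<bar>(infdist y L)\<^sup>2 - (infdist z L)\<^sup>2 - (y - z) \<bullet> (2 *\<^sub>R (z - ?P z))\<bar> \<le> (norm (y - z))\<^sup>2"
    for y
  proof -
    have "(y - ?P z) \<bullet> (y - ?P z) = (z - ?P z) \<bullet> (z - ?P z) + 2 * ((y - z) \<bullet> (z - ?P z)) + (norm (y - z))\<^sup>2"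
      by (simp add: power2_norm_eq_inner inner_diff inner_commute)
    then have upper: "(infdist y L)\<^sup>2 - (infdist z L)\<^sup>2 - 2 * ((y - z) \<bullet> (z - ?P z)) \<le> (norm (y - z))\<^sup>2"
      using le[of y z] sq[of z] by linarith
    have "(z - ?P y) \<bullet> (z - ?P y) = (y - ?P y) \<bullet> (y - ?P y) - 2 * ((y - z) \<bullet> (z - ?P z))
        - (norm (y - z))\<^sup>2 + 2 * ((y - z) \<bullet> (?P y - ?P z))"
      by (simp add: power2_norm_eq_inner inner_diff inner_commute)
    moreover have "(y - z) \<bullet> (?P y - ?P z) \<le> (norm (y - z))\<^sup>2"
    proof -
      have "(y - z) \<bullet> (?P y - ?P z) \<le> norm (y - z) * norm (?P y - ?P z)"
        by (rule norm_cauchy_schwarz)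
      also have "\<dots> \<le> norm (y - z) * norm (y - z)"
        using closest_point_lipschitz[OF assms, of y z] by (intro mult_left_mono) (auto simp: dist_norm)
      finally show ?thesis
        by (simp add: power2_eq_square)
    qed
    ultimately have "- (norm (y - z))\<^sup>2 \<le> (infdist y L)\<^sup>2 - (infdist z L)\<^sup>2 - 2 * ((y - z) \<bullet> (z - ?P z))"
      using le[of z y] sq[of y] by linarith
    with upper show ?thesis
      by (simp add: abs_le_iff)
  qed
  have "((\<lambda>y. norm ((infdist y L)\<^sup>2 - (infdist z L)\<^sup>2 - (y - z) \<bullet> (2 *\<^sub>R (z - ?P z))) / norm (y - z))
      \<longlongrightarrow> 0) (at z)"
  proof (rule Lim_null_comparison)
    show "\<forall>\<^sub>F y in at z. norm (norm ((infdist y L)\<^sup>2 - (infdist z L)\<^sup>2 - (y - z) \<bullet> (2 *\<^sub>R (z - ?P z))) / norm (y - z))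
        \<le> norm (y - z)"
      using bound by (auto simp: eventually_at_filter divide_simps power2_eq_square)
    show "((\<lambda>y. norm (y - z)) \<longlongrightarrow> 0) (at z)"
      by (auto intro!: tendsto_eq_intros)
  qed
  then show ?thesis
    unfolding gderiv_def has_derivative_iff_norm
    by (intro conjI bounded_linear_inner_left)
qed

lemma ball_plus_eq_tube:
  fixes R :: "'a::euclidean_space set"
  assumes "R \<noteq> {}"
  shows "ball 0 r + R = {z. infdist z (closure R) < r}"
proof (intro set_eqI iffI)
  fix z assume "z \<in> ball 0 r + R"
  then obtain b l where "z = b + l" "norm b < r" "l \<in> R"
    by (auto simp: set_plus_def)
  then have "infdist z (closure R) \<le> norm b"
    using infdist_le[of l "closure R" z] closure_subset by (auto simp: dist_norm)
  then show "z \<in> {z. infdist z (closure R) < r}"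
    using \<open>norm b < r\<close> by simp
next
  fix z assume "z \<in> {z. infdist z (closure R) < r}"
  then have d: "dist z (closest_point (closure R) z) < r"
    using assms by (simp add: infdist_eq_dist_closest_point)
  moreover have "closest_point (closure R) z \<in> closure R"
    using assms by (simp add: closest_point_in_set)
  ultimately obtain l where l: "l \<in> R" "dist l (closest_point (closure R) z) < r - dist z (closest_point (closure R) z)"
    by (meson closure_approachable diff_gt_0_iff_gt)
  then have "dist z l < r"
    using dist_triangle2[of z l "closest_point (closure R) z"] by linarith
  then have "z - l \<in> ball 0 r"
    by (simp add: dist_norm norm_minus_commute)
  then show "z \<in> ball 0 r + R"
    using set_plus_intro[OF _ l(1), of "z - l" "ball 0 r"] by simp
qed

text \<open>
  A point at distance \<open>r\<close> from \<open>L\<close> is on the sphere of radius \<open>r\<close> about its closest point, and the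
  open ball bounded by that sphere lies in the tube.
\<close>

lemma frontier_tube:
  fixes L :: "'a::euclidean_space set"
  assumes "closed L" "L \<noteq> {}" "r > 0"
  shows "frontier {z. infdist z L < r} = {z. infdist z L = r}"
proof -
  have "open {z. infdist z L < r}"
    by (intro open_Collect_less continuous_intros)
  moreover have "closure {z. infdist z L < r} = {z. infdist z L \<le> r}"
  proof
    show "closure {z. infdist z L < r} \<subseteq> {z. infdist z L \<le> r}"
      by (intro closure_minimal closed_Collect_le continuous_intros) auto
    show "{z. infdist z L \<le> r} \<subseteq> closure {z. infdist z L < r}"
    proof
      fix z assume "z \<in> {z. infdist z L \<le> r}"
      then have "z \<in> cball (closest_point L z) r"
        using assms by (simp add: infdist_eq_dist_closest_point dist_commute)
      moreover have "ball (closest_point L z) r \<subseteq> {z. infdist z L < r}"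
      proof
        fix y assume "y \<in> ball (closest_point L z) r"
        then show "y \<in> {z. infdist z L < r}"
          using infdist_le[OF closest_point_in_set[OF assms(1,2)], of y z]
          by (auto simp: dist_commute)
      qed
      ultimately show "z \<in> closure {z. infdist z L < r}"
        using closure_mono assms(3) closure_ball by blast
    qed
  qed
  ultimately show ?thesis
    by (auto simp: frontier_def interior_open)
qed

text \<open>
  The defining function is the squared distance minus \<open>r\<^sup>2\<close>, on the complement of \<open>L\<close>, where its
  gradient does not vanish.
\<close>

lemma outward_unit_normal_tube:
  fixes L :: "'a::euclidean_space set"
  assumes L: "convex L" "closed L" "L \<noteq> {}" and r: "r > 0" and z: "infdist z L = r"
  shows "outward_unit_normal {z. infdist z L < r} z ((z - closest_point L z) /\<^sub>R r)"
  unfolding outward_unit_normal_def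
proof (intro conjI exI)
  let ?g = "\<lambda>y. (infdist y L)\<^sup>2 - r\<^sup>2" and ?G = "\<lambda>y. 2 *\<^sub>R (y - closest_point L y)"
  show "z \<in> frontier {z. infdist z L < r}"
    using frontier_tube[OF L(2,3) r] z by simp
  show "open (- L)" "z \<in> - L"
    using L z r by auto
  show "\<forall>y\<in>- L. GDERIV ?g y :> ?G y \<and> ?G y \<noteq> 0"
  proof (intro ballI conjI)
    fix y assume "y \<in> - L"
    then show "?G y \<noteq> 0"
      using closest_point_in_set[OF L(2,3), of y] by auto
    show "GDERIV ?g y :> ?G y"
      using GDERIV_diff[OF GDERIV_infdist_sq[OF L] GDERIV_const] by simp
  qed
  show "continuous_on (- L) ?G"
    by (intro continuous_intros continuous_on_closest_point L)
  have "?g y < 0 \<longleftrightarrow> infdist y L < r" "?g y = 0 \<longleftrightarrow> infdist y L = r" for y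
  proof -
    have "?g y = (infdist y L - r) * (infdist y L + r)" "infdist y L + r > 0"
      using r infdist_nonneg[of y L] by (simp_all add: power2_eq_square algebra_simps)
    then show "?g y < 0 \<longleftrightarrow> infdist y L < r" "?g y = 0 \<longleftrightarrow> infdist y L = r"
      by (simp_all add: mult_less_0_iff)
  qed
  then show "{z. infdist z L < r} \<inter> - L = {y \<in> - L. ?g y < 0}"
    "frontier {z. infdist z L < r} \<inter> - L = {y \<in> - L. ?g y = 0}"
    by (auto simp: frontier_tube[OF L(2,3) r])
  have "norm (z - closest_point L z) = r"
    using z L by (simp add: infdist_eq_dist_closest_point dist_norm)
  then show "(z - closest_point L z) /\<^sub>R r = ?G z /\<^sub>R norm (?G z)"
    by simp
qed

section \<open>Normals under linear isomorphisms\<close>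

lemma frontier_injective_linear_image:
  fixes f :: "'a::euclidean_space \<Rightarrow> 'a"
  assumes "linear f" "inj f"
  shows "frontier (f ` S) = f ` frontier S"
  using closure_injective_linear_image[OF assms, of S] interior_injective_linear_image[OF assms, of S]
  by (simp add: frontier_def image_set_diff[OF assms(2)])

text \<open>
  If \<open>g\<close> defines \<open>S\<close> near \<open>x\<close>, then \<open>g \<circ> h\<close> defines the image near \<open>f x\<close>, where \<open>h\<close> is the inverse of
  \<open>f\<close>; by the chain rule its gradient is the adjoint of \<open>h\<close> applied to that of \<open>g\<close>.
\<close>

lemma outward_unit_normal_linear_image:
  fixes f :: "'a::euclidean_space \<Rightarrow> 'a"
  assumes f: "linear f" and h: "linear h" and fh: "\<And>y. f (h y) = y" and hf: "\<And>x. h (f x) = x"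
    and S: "outward_unit_normal S x n"
  shows "outward_unit_normal (f ` S) (f x) (adjoint h n /\<^sub>R norm (adjoint h n))"
proof -
  obtain U g G where U: "open U" "x \<in> U" and g: "\<And>y. y \<in> U \<Longrightarrow> GDERIV g y :> G y \<and> G y \<noteq> 0"
    and G: "continuous_on U G" and SU: "S \<inter> U = {y \<in> U. g y < 0}"
    and FU: "frontier S \<inter> U = {y \<in> U. g y = 0}" and n: "n = G x /\<^sub>R norm (G x)"
    and x: "x \<in> frontier S"
    using S unfolding outward_unit_normal_def by blast
  have inj: "inj f"
    by (metis hf injI)
  have im: "f ` X = h -` X" for X
    by (auto simp: hf) (metis fh image_eqI)
  have adj: "v \<bullet> adjoint h w = h v \<bullet> w" for v w
    by (rule adjoint_works[OF h])
  have lin: "linear (adjoint h)"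
    by (rule adjoint_linear[OF h])
  have adj0: "adjoint h w \<noteq> 0" if "w \<noteq> 0" for w
    using adj[of "f w" w] that by (auto simp: hf)
  have conth: "continuous_on X h" for X
    using h by (rule linear_continuous_on_compose[OF continuous_on_id])
  show ?thesis
    unfolding outward_unit_normal_def
  proof (intro conjI exI)
    show "f x \<in> frontier (f ` S)"
      using x by (simp add: frontier_injective_linear_image[OF f inj])
    show "open (f ` U)"
      unfolding im by (intro open_vimage U conth)
    show "f x \<in> f ` U"
      using U by blast
    show "\<forall>y\<in>f ` U. GDERIV (\<lambda>y. g (h y)) y :> adjoint h (G (h y)) \<and> adjoint h (G (h y)) \<noteq> 0"
    proof (intro ballI conjI)
      fix y assume "y \<in> f ` U"
      then have y: "h y \<in> U"
        by (auto simp: hf)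
      then have "(g has_derivative (\<lambda>v. v \<bullet> G (h y))) (at (h y))"
        using g by (simp add: gderiv_def)
      from has_derivative_compose[OF linear_imp_has_derivative[OF h] this]
      show "GDERIV (\<lambda>y. g (h y)) y :> adjoint h (G (h y))"
        by (simp add: gderiv_def adj)
      show "adjoint h (G (h y)) \<noteq> 0"
        using g[OF y] adj0 by blast
    qed
    show "continuous_on (f ` U) (\<lambda>y. adjoint h (G (h y)))"
      by (intro linear_continuous_on_compose[OF _ lin] continuous_on_compose2[OF G conth])
        (auto simp: hf)
    show "f ` S \<inter> f ` U = {y \<in> f ` U. g (h y) < 0}"
      using SU unfolding im by auto
    show "frontier (f ` S) \<inter> f ` U = {y \<in> f ` U. g (h y) = 0}"
    proof -
      have "f ` (frontier S \<inter> U) = {y \<in> f ` U. g (h y) = 0}"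
        unfolding FU im by auto
      then show ?thesis
        by (simp add: frontier_injective_linear_image[OF f inj] image_Int[OF inj])
    qed
    have "G x \<noteq> 0"
      using g U by blast
    then show "adjoint h n /\<^sub>R norm (adjoint h n) =
        adjoint h (G (h (f x))) /\<^sub>R norm (adjoint h (G (h (f x))))"
      by (simp add: n hf linear_scale[OF lin])
  qed
qed

section \<open>Maximizers of linear functionals on Minkowski sums\<close>

text \<open>
  A sum of terms each bounded by its maximum attains the sum of the maxima only if every term is
  maximal, which by uniqueness determines the summands of \<open>y\<close>.
\<close>

lemma unique_maximizer_set_sum:
  fixes K :: "'i \<Rightarrow> 'a::real_inner set"
  assumes "finite I"
    and max: "\<And>i y. i \<in> I \<Longrightarrow> y \<in> K i \<Longrightarrow> n \<bullet> y \<le> n \<bullet> p i"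
    and uniq: "\<And>i y. i \<in> I \<Longrightarrow> y \<in> K i \<Longrightarrow> n \<bullet> y = n \<bullet> p i \<Longrightarrow> y = p i"
    and y: "y \<in> (\<Sum>i\<in>I. K i)"
  shows "n \<bullet> y \<le> n \<bullet> (\<Sum>i\<in>I. p i)"
    and "n \<bullet> y = n \<bullet> (\<Sum>i\<in>I. p i) \<Longrightarrow> y = (\<Sum>i\<in>I. p i)"
proof -
  obtain s where s: "y = (\<Sum>i\<in>I. s i)" "\<And>i. i \<in> I \<Longrightarrow> s i \<in> K i"
    using y set_sum_alt[OF assms(1), of K] by auto
  show "n \<bullet> y \<le> n \<bullet> (\<Sum>i\<in>I. p i)"
    using s max by (auto simp: inner_sum_right intro: sum_mono)
  assume "n \<bullet> y = n \<bullet> (\<Sum>i\<in>I. p i)"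
  then have "(\<Sum>i\<in>I. n \<bullet> s i) = (\<Sum>i\<in>I. n \<bullet> p i)"
    by (simp add: s inner_sum_right)
  then have "\<And>i. i \<in> I \<Longrightarrow> n \<bullet> s i = n \<bullet> p i"
    using sum_mono_inv[of "\<lambda>i. n \<bullet> s i" I "\<lambda>i. n \<bullet> p i"] s(2) max assms(1) by blast
  then show "y = (\<Sum>i\<in>I. p i)"
    using s uniq by (auto intro: sum.cong)
qed

lemma sum_in_closure_set_sum:
  fixes E :: "'i \<Rightarrow> 'a::real_normed_vector set"
  assumes "finite I" "\<And>i. i \<in> I \<Longrightarrow> p i \<in> closure (E i)"
  shows "(\<Sum>i\<in>I. p i) \<in> closure (\<Sum>i\<in>I. E i)"
  using assms
proof (induction I rule: finite_induct)
  case (insert i I)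
  then have "p i + (\<Sum>i\<in>I. p i) \<in> closure (E i) + closure (\<Sum>i\<in>I. E i)"
    by (intro set_plus_intro) auto
  then show ?case
    using insert closure_sum by auto
qed simp

lemma compact_set_sum:
  fixes K :: "'i \<Rightarrow> 'a::real_normed_vector set"
  assumes "finite I" "\<And>i. i \<in> I \<Longrightarrow> compact (K i)"
  shows "compact (\<Sum>i\<in>I. K i)"
  using assms
proof (induction I rule: finite_induct)
  case (insert i I)
  then have "compact {x + y | x y. x \<in> K i \<and> y \<in> (\<Sum>i\<in>I. K i)}"
    by (intro compact_sums) auto
  also have "{x + y | x y. x \<in> K i \<and> y \<in> (\<Sum>i\<in>I. K i)} = K i + (\<Sum>i\<in>I. K i)"
    by (auto simp: set_plus_def)
  finally show ?case
    using insert by simp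
qed simp

section \<open>Ellipsoids\<close>

lemma solid_ellipsoid_eq_image: "solid_ellipsoid A = (*v) A ` ball 0 1"
  by (auto simp: solid_ellipsoid_def)

lemma closure_solid_ellipsoid:
  fixes A :: "real^'n^'n"
  shows "(*v) A ` cball 0 1 \<subseteq> closure (solid_ellipsoid A)"
  unfolding solid_ellipsoid_eq_image
  using closure_linear_image_subset[of "(*v) A" "ball 0 1"] by simp

lemma sym_pos_def_inner:
  fixes A :: "real^'n^'n"
  assumes "sym_pos_def A"
  shows "x \<bullet> (A *v y) = (A *v x) \<bullet> y"
  using assms by (metis dot_lmul_matrix sym_pos_def_def transpose_matrix_vector)

lemma sym_pos_def_nonzero:
  assumes "sym_pos_def A" "v \<noteq> 0"
  shows "A *v v \<noteq> 0"
  using assms unfolding sym_pos_def_def by force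

lemma sym_pos_def_inverse:
  fixes A :: "real^'n^'n"
  assumes "sym_pos_def A"
  obtains B where "\<And>x. A *v (B *v x) = x" "\<And>x. B *v (A *v x) = x"
proof -
  obtain B where "B ** A = mat 1"
    using matrix_left_invertible_ker[of A] sym_pos_def_nonzero[OF assms] by blast
  moreover from this have "A ** B = mat 1"
    by (simp add: matrix_left_right_inverse)
  ultimately show thesis
    using that[of B] by (simp add: matrix_vector_mul_assoc)
qed

text \<open>
  The gradient at \<open>n\<close> of the support function \<open>n \<mapsto> \<parallel>A n\<parallel>\<close> of the ellipsoid of a symmetric \<open>A\<close>.
\<close>

definition support_point :: "real^'n^'n \<Rightarrow> real^'n \<Rightarrow> real^'n" where
  "support_point A n = A *v (A *v n) /\<^sub>R norm (A *v n)"

lemma support_point_eq_image: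
  "support_point A n = A *v ((A *v n) /\<^sub>R norm (A *v n))"
  by (simp add: support_point_def matrix_vector_mult_scaleR)

text \<open>
  By symmetry \<open>n \<bullet> A v = A n \<bullet> v\<close>, and for \<open>v\<close> in the closed unit ball the Cauchy-Schwarz inequality
  bounds this by \<open>\<parallel>A n\<parallel>\<close>, with equality only for the unit vector in the direction of \<open>A n\<close>.
\<close>

lemma
  fixes A :: "real^'n^'n"
  assumes A: "sym_pos_def A" and n: "n \<noteq> 0"
  shows support_point_in: "support_point A n \<in> (*v) A ` cball 0 1"
    and support_point_max: "\<And>y. y \<in> (*v) A ` cball 0 1 \<Longrightarrow> n \<bullet> y \<le> n \<bullet> support_point A n"
    and support_point_unique:
      "\<And>y. y \<in> (*v) A ` cball 0 1 \<Longrightarrow> n \<bullet> y = n \<bullet> support_point A n \<Longrightarrow> y = support_point A n"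
proof -
  have pos: "norm (A *v n) > 0"
    using sym_pos_def_nonzero[OF A n] by simp
  show "support_point A n \<in> (*v) A ` cball 0 1"
    unfolding support_point_eq_image using pos by (intro imageI) simp
  have val: "n \<bullet> support_point A n = norm (A *v n)"
    using pos by (simp add: support_point_eq_image sym_pos_def_inner[OF A] flip: power2_norm_eq_inner)
      (simp add: power2_eq_square)
  fix y assume "y \<in> (*v) A ` cball 0 1"
  then obtain v where v: "y = A *v v" "norm v \<le> 1"
    by auto
  have ny: "n \<bullet> y = (A *v n) \<bullet> v"
    by (simp add: v sym_pos_def_inner[OF A])
  have cs: "(A *v n) \<bullet> v \<le> norm (A *v n) * norm v"
    by (rule norm_cauchy_schwarz)
  have le: "norm (A *v n) * norm v \<le> norm (A *v n)"
    using v(2) pos by (simp add: mult_le_cancel_left1)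
  show "n \<bullet> y \<le> n \<bullet> support_point A n"
    using ny val cs le by linarith
  assume "n \<bullet> y = n \<bullet> support_point A n"
  then have eq: "(A *v n) \<bullet> v = norm (A *v n) * norm v" and "norm (A *v n) * norm v = norm (A *v n)"
    using ny val cs le by linarith+
  then have "norm v = 1"
    using pos by simp
  then have "norm (A *v n) *\<^sub>R v = A *v n"
    using eq norm_cauchy_schwarz_eq[of "A *v n" v] by simp
  then have "v = (A *v n) /\<^sub>R norm (A *v n)"
    using pos by (metis less_irrefl scaleR_scaleR left_inverse scaleR_one)
  then show "y = support_point A n"
    by (simp add: v support_point_eq_image)
qed

section \<open>The boundary of a sum of ellipsoids\<close>

text \<open>
  The closure of the sum is contained in the sum of the closed ellipsoids, which is compact and
  therefore closed; on the latter the unique maximizers add up.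
\<close>

lemma
  fixes A :: "'i \<Rightarrow> real^'n^'n"
  assumes I: "finite I" and A: "\<And>i. i \<in> I \<Longrightarrow> sym_pos_def (A i)" and n: "n \<noteq> 0"
  shows sum_support_point_in_closure:
      "(\<Sum>i\<in>I. support_point (A i) n) \<in> closure (\<Sum>i\<in>I. solid_ellipsoid (A i))"
    and sum_support_point_max:
      "\<And>y. y \<in> closure (\<Sum>i\<in>I. solid_ellipsoid (A i)) \<Longrightarrow> n \<bullet> y \<le> n \<bullet> (\<Sum>i\<in>I. support_point (A i) n)"
    and sum_support_point_unique:
      "\<And>y. y \<in> closure (\<Sum>i\<in>I. solid_ellipsoid (A i)) \<Longrightarrow> n \<bullet> y = n \<bullet> (\<Sum>i\<in>I. support_point (A i) n)
        \<Longrightarrow> y = (\<Sum>i\<in>I. support_point (A i) n)"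
proof -
  let ?K = "\<lambda>i. (*v) (A i) ` cball 0 1"
  show "(\<Sum>i\<in>I. support_point (A i) n) \<in> closure (\<Sum>i\<in>I. solid_ellipsoid (A i))"
    using closure_solid_ellipsoid support_point_in[OF A n]
    by (intro sum_in_closure_set_sum I) blast
  have "(\<Sum>i\<in>I. solid_ellipsoid (A i)) \<subseteq> (\<Sum>i\<in>I. ?K i)"
    unfolding set_sum_alt[OF I] by (fastforce simp: solid_ellipsoid_eq_image)
  moreover have "closed (\<Sum>i\<in>I. ?K i)"
    by (intro compact_imp_closed compact_set_sum I compact_continuous_image
        linear_continuous_on matrix_vector_mul_bounded_linear compact_cball)
  ultimately have sub: "closure (\<Sum>i\<in>I. solid_ellipsoid (A i)) \<subseteq> (\<Sum>i\<in>I. ?K i)"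
    by (rule closure_minimal)
  fix y assume "y \<in> closure (\<Sum>i\<in>I. solid_ellipsoid (A i))"
  with sub have y: "y \<in> (\<Sum>i\<in>I. ?K i)"
    by blast
  note max = unique_maximizer_set_sum[OF I _ _ y, of n "\<lambda>i. support_point (A i) n",
      OF support_point_max[OF A n] support_point_unique[OF A n]]
  show "n \<bullet> y \<le> n \<bullet> (\<Sum>i\<in>I. support_point (A i) n)"
    by (rule max(1)) auto
  show "y = (\<Sum>i\<in>I. support_point (A i) n)"
    if "n \<bullet> y = n \<bullet> (\<Sum>i\<in>I. support_point (A i) n)"
    by (rule max(2)) (use that in auto)
qed

lemma convex_sum_solid_ellipsoid: "convex (\<Sum>i\<in>I. solid_ellipsoid (A i))"
  by (auto intro!: convex_set_sum convex_linear_image simp: solid_ellipsoid_eq_image)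

lemma zero_in_sum_solid_ellipsoid:
  assumes "finite I"
  shows "0 \<in> (\<Sum>i\<in>I. solid_ellipsoid (A i))"
proof -
  have "0 \<in> solid_ellipsoid (A i)" for i
    unfolding solid_ellipsoid_eq_image by (rule image_eqI[of _ _ 0]) auto
  then show ?thesis
    unfolding set_sum_alt[OF assms] by (auto intro!: exI[of _ "\<lambda>_. 0"])
qed

lemma open_sum_solid_ellipsoid:
  fixes A :: "'i \<Rightarrow> real^'n^'n"
  assumes I: "finite I" "I \<noteq> {}" and A: "\<And>i. i \<in> I \<Longrightarrow> sym_pos_def (A i)"
  shows "open (\<Sum>i\<in>I. solid_ellipsoid (A i))"
proof -
  obtain k where k: "k \<in> I"
    using I by blast
  have "surj ((*v) (A k))"
    by (metis sym_pos_def_inverse[OF A[OF k]] surjI)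
  then have "open (solid_ellipsoid (A k))"
    unfolding solid_ellipsoid_eq_image by (intro open_surjective_linear_image) auto
  then have "open (\<Union>x\<in>solid_ellipsoid (A k). \<Union>y\<in>(\<Sum>i\<in>I - {k}. solid_ellipsoid (A i)). {x + y})"
    by (intro open_sums) auto
  also have "\<dots> = solid_ellipsoid (A k) + (\<Sum>i\<in>I - {k}. solid_ellipsoid (A i))"
    by (auto simp: set_plus_def)
  also have "\<dots> = (\<Sum>i\<in>I. solid_ellipsoid (A i))"
    using I k by (simp add: sum.remove)
  finally show ?thesis .
qed

text \<open>
  One ellipsoid, with index \<open>k\<close>, is turned into the unit ball by the inverse \<open>B\<close> of its matrix, so
  that the sum becomes a tube. The support point of the whole sum corresponds to \<open>u + B q\<close>, where
  \<open>q\<close> is the support point of the remaining sum \<open>R\<close> and \<open>u\<close> is a unit vector. That \<open>q\<close> maximizes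
  \<open>n \<bullet> y\<close> over \<open>R\<close> says exactly that \<open>B q\<close> is the closest point, so \<open>u\<close> is the normal of the tube.
\<close>

lemma outward_unit_normal_sum_support_point:
  fixes A :: "'i \<Rightarrow> real^'n^'n"
  assumes I: "finite I" "I \<noteq> {}" and A: "\<And>i. i \<in> I \<Longrightarrow> sym_pos_def (A i)" and n: "norm n = 1"
  shows "outward_unit_normal (\<Sum>i\<in>I. solid_ellipsoid (A i)) (\<Sum>i\<in>I. support_point (A i) n) n"
proof -
  obtain k where k: "k \<in> I"
    using I by blast
  define R where "R = (\<Sum>i\<in>I - {k}. solid_ellipsoid (A i))"
  define q where "q = (\<Sum>i\<in>I - {k}. support_point (A i) n)"
  have n0: "n \<noteq> 0"
    using n by auto
  note Ak = A[OF k]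
  obtain B where AB: "\<And>x. A k *v (B *v x) = x" and BA: "\<And>x. B *v (A k *v x) = x"
    using sym_pos_def_inverse[OF Ak] by blast
  define L where "L = closure ((*v) B ` R)"
  have R: "R \<noteq> {}" "convex R"
    using zero_in_sum_solid_ellipsoid[of "I - {k}" A] I
    by (auto simp: R_def convex_sum_solid_ellipsoid)
  have L: "convex L" "closed L" "L \<noteq> {}"
    using R by (auto simp: L_def intro!: convex_closure convex_linear_image)
  have inL: "A k *v l \<in> closure R" if "l \<in> L" for l
  proof -
    have "A k *v l \<in> closure ((*v) (A k) ` (*v) B ` R)"
      using that closure_linear_image_subset[of "(*v) (A k)" "(*v) B ` R"] unfolding L_def by auto
    then show ?thesis
      by (simp add: image_image AB)
  qed
  have "(\<Sum>i\<in>I. solid_ellipsoid (A i)) = (*v) (A k) ` ball 0 1 + R"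
    using I k by (simp add: R_def sum.remove solid_ellipsoid_eq_image)
  also have "\<dots> = (*v) (A k) ` (ball 0 1 + (*v) B ` R)"
    unfolding set_plus_image
    by (force simp: image_iff matrix_vector_right_distrib AB)
  also have "\<dots> = (*v) (A k) ` {z. infdist z L < 1}"
    using R by (simp add: ball_plus_eq_tube L_def)
  finally have sum_eq: "(\<Sum>i\<in>I. solid_ellipsoid (A i)) = (*v) (A k) ` {z. infdist z L < 1}" .
  define u where "u = (A k *v n) /\<^sub>R norm (A k *v n)"
  have Akn: "norm (A k *v n) > 0"
    using sym_pos_def_nonzero[OF Ak n0] by simp
  have u: "norm u = 1"
    using Akn by (simp add: u_def)
  have q: "q \<in> closure R"
    unfolding q_def R_def using I A n0 by (intro sum_support_point_in_closure) auto
  have BqL: "B *v q \<in> L"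
    unfolding L_def using closure_linear_image_subset[of "(*v) B" R] q by auto
  have "(\<Sum>i\<in>I. support_point (A i) n) = A k *v (u + B *v q)"
    using I k by (simp add: q_def u_def sum.remove support_point_eq_image matrix_vector_right_distrib AB)
  moreover have cp: "closest_point L (u + B *v q) = B *v q"
  proof (rule closest_point_obtuse[OF L(1,2) BqL])
    fix l assume "l \<in> L"
    have "n \<bullet> (A k *v l) \<le> n \<bullet> q"
      using inL[OF \<open>l \<in> L\<close>] I A n0 unfolding q_def R_def by (intro sum_support_point_max) auto
    moreover have "(A k *v n) \<bullet> (l - B *v q) = n \<bullet> (A k *v l) - n \<bullet> q"
      by (simp add: sym_pos_def_inner[OF Ak, symmetric] matrix_vector_mult_diff_distrib AB inner_diff_right)
    ultimately show "(u + B *v q - B *v q) \<bullet> (l - B *v q) \<le> 0"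
      using Akn by (simp add: u_def mult_le_0_iff)
  qed
  moreover have "outward_unit_normal {z. infdist z L < 1} (u + B *v q) u"
    using outward_unit_normal_tube[OF L, of 1 "u + B *v q"] L cp u
    by (simp add: infdist_eq_dist_closest_point dist_norm)
  moreover have "adjoint ((*v) B) u /\<^sub>R norm (adjoint ((*v) B) u) = n"
  proof -
    have "v \<bullet> adjoint ((*v) B) u = v \<bullet> (n /\<^sub>R norm (A k *v n))" for v
      by (simp add: adjoint_works u_def sym_pos_def_inner[OF Ak] AB)
    then have "adjoint ((*v) B) u = n /\<^sub>R norm (A k *v n)"
      using vector_eq_rdot by (metis inner_commute)
    then show ?thesis
      using Akn n by simp
  qed
  ultimately show ?thesis
    using outward_unit_normal_linear_image[of "(*v) (A k)" "(*v) B" "{z. infdist z L < 1}" "u + B *v q" u]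
    by (simp add: sum_eq AB BA)
qed

text \<open>
  A hyperplane that separates the frontier point \<open>x\<close> from the open convex sum has a unit normal \<open>n\<close>
  for which \<open>x\<close> is at least as high as the support point. As \<open>x\<close> is in the closure, it equals it.
\<close>

lemma frontier_sum_solid_ellipsoid_subset:
  fixes A :: "'i \<Rightarrow> real^'n^'n"
  assumes I: "finite I" "I \<noteq> {}" and A: "\<And>i. i \<in> I \<Longrightarrow> sym_pos_def (A i)"
  shows "frontier (\<Sum>i\<in>I. solid_ellipsoid (A i)) \<subseteq> (\<lambda>n. \<Sum>i\<in>I. support_point (A i) n) ` sphere 0 1"
proof
  let ?S = "\<Sum>i\<in>I. solid_ellipsoid (A i)"
  fix x assume x: "x \<in> frontier ?S"
  show "x \<in> (\<lambda>n. \<Sum>i\<in>I. support_point (A i) n) ` sphere 0 1"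
  proof -
    have "open ?S"
      using I A by (intro open_sum_solid_ellipsoid)
    then have "x \<notin> ?S" and xcl: "x \<in> closure ?S"
      using x by (auto simp: frontier_def interior_open)
    then obtain a b where a: "a \<noteq> 0" "\<And>y. y \<in> ?S \<Longrightarrow> a \<bullet> y \<le> b" "a \<bullet> x \<ge> b"
      using separating_hyperplane_sets[of ?S "{x}"] convex_sum_solid_ellipsoid[of A I]
        zero_in_sum_solid_ellipsoid[OF I(1), of A] by auto
    define n where "n = a /\<^sub>R norm a"
    have n: "norm n = 1" "n \<noteq> 0"
      using a(1) by (auto simp: n_def)
    let ?p = "\<Sum>i\<in>I. support_point (A i) n"
    have "closure ?S \<subseteq> {y. a \<bullet> y \<le> b}"
      using a(2) by (intro closure_minimal closed_halfspace_le) auto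
    then have "a \<bullet> ?p \<le> b"
      using sum_support_point_in_closure[of I A n] I A n(2) by blast
    then have "n \<bullet> ?p \<le> n \<bullet> x"
      using a(1,3) by (simp add: n_def divide_right_mono)
    moreover have "n \<bullet> x \<le> n \<bullet> ?p"
      using I A n(2) xcl by (intro sum_support_point_max)
    ultimately have "x = ?p"
      using I A n(2) xcl by (intro sum_support_point_unique) auto
    then show ?thesis
      using n(1) by (intro image_eqI[of _ _ n]) auto
  qed
qed

theorem theorem1p1:
  fixes A :: "nat \<Rightarrow> real^'n^'n" and m :: nat
  assumes "m \<ge> 1"
    and "\<And>j. j \<in> {1..m} \<Longrightarrow> sym_pos_def (A j)"
  shows "frontier (ellipsoid_sum m A) = boundary_param m A ` sphere 0 1
    \<and> (\<forall>n \<in> sphere 0 1. outward_unit_normal (ellipsoid_sum m A) (boundary_param m A n) n)"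
proof -
  have S: "ellipsoid_sum m A = (\<Sum>i\<in>{1..m}. solid_ellipsoid (A i))"
    by (simp add: ellipsoid_sum_def)
  have b: "boundary_param m A = (\<lambda>n. \<Sum>i\<in>{1..m}. support_point (A i) n)"
    by (simp add: fun_eq_iff boundary_param_def support_point_def matrix_vector_mul_assoc)
  have normal: "outward_unit_normal (ellipsoid_sum m A) (boundary_param m A n) n" if "n \<in> sphere 0 1" for n
    unfolding S b using that assms by (intro outward_unit_normal_sum_support_point) auto
  moreover have "boundary_param m A n \<in> frontier (ellipsoid_sum m A)" if "n \<in> sphere 0 1" for n
    using normal[OF that] by (simp add: outward_unit_normal_def)
  moreover have "frontier (ellipsoid_sum m A) \<subseteq> boundary_param m A ` sphere 0 1"
    unfolding S b using assms by (intro frontier_sum_solid_ellipsoid_subset) auto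
  ultimately show ?thesis
    by blast
qed

end
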